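(* Let $\mathcal{V}:\mathcal{M}\to[-\infty,+\infty]$ satisfy (V1)--(V3). Then the functional $\Phi:\mathcal{L}\to[-\infty,+\infty]$ defined by $$\Phi(p):=\mathcal{V}^*(p)=\sup_{X\in\mathcal{M}}\{\mathbb{E}[pX]-\mathcal{V}(X)\}$$ is proper, $\sigma(\mathcal{L},\mathcal{M})$-lower semicontinuous, convex and satisfies the following properties: (1) $\Phi(p)\ge 0$ for all $p\in\mathcal{L}$; (2) $\Phi(p)=0$ if $p\equiv 1$ a.s.; (3) $\Phi(p)<\infty$ implies $p\ge 0$ a.s.; (4) if $\partial\mathcal{V}(0)=\{1\}$, then $\Phi(p)=0$ implies $p\equiv 1$ a.s.; (5) if $\partial\mathcal{V}(0)=\{1\}$, then $\mathrm{dom}\,\Phi=\{1\}$ if and only if $\mathcal{V}$ is positively homogeneous.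
   Context: $(\Theta,\mathcal{B},\Pi)$ is a complete probability space and $\mathbb{E}$ is expectation with respect to $\Pi$. $\mathcal{L}$ and $\mathcal{M}$ are Banach spaces of ($\Pi$-a.s. equivalence classes of) $\mathcal{B}$-measurable functions $\Theta\to\mathbb{R}$, both containing all simple functions, such that $\mathbb{E}[|pX|]<\infty$ for all $p\in\mathcal{L}$, $X\in\mathcal{M}$. They are paired by $\langle p,X\rangle=\mathbb{E}[pX]$; through this pairing $\mathcal{L}$ is identified with a subspace of the topological dual $\mathcal{M}^*$ and $\mathcal{M}$ with a subspace of $\mathcal{L}^*$, and it is assumed that $\mathcal{L}=\mathcal{M}^*$ or $\mathcal{M}=\mathcal{L}^*$. $\sigma(\mathcal{M},\mathcal{L})$ and $\sigma(\mathcal{L},\mathcal{M})$ denote the weak topologies induced by the pairing. Conditions on $\mathcal{V}:\mathcal{M}\to[-\infty,+\infty]$: (V1) $\mathcal{V}$ is proper, $\sigma(\mathcal{M},\mathcal{L})$-lower semicontinuous and convex. (V2) $\mathcal{V}(X)\ge\mathbb{E}[X]$ for all $X\in\mathcal{M}$, with $\mathcal{V}(X)=\mathbb{E}[X]$ if and only if $X\equiv 0$. (V3) If $X,X'\in\mathcal{M}$ and $X\le X'$ a.s., then $\mathcal{V}(X)\le\mathcal{V}(X')$. $\partial f(x)=\{\eta\in\mathcal{M}^*: f(x')-f(x)\ge\langle\eta,x'-x\rangle\ \forall x'\in\mathcal{M}\}$ is the convex subdifferential of $f:\mathcal{M}\to[-\infty,+\infty]$; $\mathrm{dom}\,f=\{f<\infty\}$;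 $1$ denotes the constant function. $\mathcal{V}$ is positively homogeneous if $\mathcal{V}(tX)=t\mathcal{V}(X)$ for all $t\ge 0$, $X\in\mathcal{M}$. *)

theory Defs
  imports "HOL-Probability.Probability"
begin

section \<open>Banach spaces of random variables\<close>

text \<open>
  A Banach space of a.s. equivalence classes of measurable functions is a Banach space \<^typ>\<open>'b\<close>
  together with a map \<open>rep\<close> choosing, for each element (an equivalence class), a measurable
  representative. Equality in \<^typ>\<open>'b\<close> is a.s. equality of representatives, and the vector
  space operations are the pointwise ones up to null sets. Nothing links the norm of
  \<^typ>\<open>'b\<close> to \<open>rep\<close>.
\<close>

locale random_variable_space =
  fixes P :: "'a measure" and rep :: "'b::banach \<Rightarrow> 'a \<Rightarrow> real"
  assumes rep_measurable: "rep x \<in> borel_measurable P"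
    and rep_eqI: "(AE \<omega> in P. rep x \<omega> = rep y \<omega>) \<Longrightarrow> x = y"
    and rep_add: "AE \<omega> in P. rep (x + y) \<omega> = rep x \<omega> + rep y \<omega>"
    and rep_scaleR: "AE \<omega> in P. rep (c *\<^sub>R x) \<omega> = c * rep x \<omega>"
    and rep_simple: "simple_function P f \<Longrightarrow> \<exists>x. AE \<omega> in P. rep x \<omega> = f \<omega>"

text \<open>The element of the space whose members are the functions a.s. equal to \<open>f\<close>
  (meaningful only if there is one).\<close>

definition ae_class :: "'a measure \<Rightarrow> ('b \<Rightarrow> 'a \<Rightarrow> real) \<Rightarrow> ('a \<Rightarrow> real) \<Rightarrow> 'b" where
  "ae_class P rep f = (THE x. AE \<omega> in P. rep x \<omega> = f \<omega>)"

lemma (in random_variable_space) ae_class_simple: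
  assumes "simple_function P f"
  shows "AE \<omega> in P. rep (ae_class P rep f) \<omega> = f \<omega>"
proof -
  obtain x where x: "AE \<omega> in P. rep x \<omega> = f \<omega>"
    using rep_simple[OF assms] by blast
  have "y = x" if "AE \<omega> in P. rep y \<omega> = f \<omega>" for y
    by (rule rep_eqI) (use that x in eventually_elim, simp)
  with x show ?thesis
    unfolding ae_class_def by (rule theI)
qed


section \<open>Paired spaces\<close>

definition pairing ::
  "'a measure \<Rightarrow> ('l \<Rightarrow> 'a \<Rightarrow> real) \<Rightarrow> ('m \<Rightarrow> 'a \<Rightarrow> real) \<Rightarrow> 'l \<Rightarrow> 'm \<Rightarrow> real" where
  "pairing P L M p X = (\<integral>\<omega>. L p \<omega> * M X \<omega> \<partial>P)"

text \<open>
  The assumptions \<open>pairing_bounded_left\<close> and \<open>pairing_bounded_right\<close> say that each space is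
  mapped by the pairing into the topological dual of the other one; injectivity of these maps
  follows from the presence of the simple functions. The two norms need not be dual to each
  other isometrically.
\<close>

locale paired_spaces =
  prob_space P + complete_measure P +
  L: random_variable_space P L + M: random_variable_space P M
  for P :: "'a measure" and L :: "'l::banach \<Rightarrow> 'a \<Rightarrow> real" and M :: "'m::banach \<Rightarrow> 'a \<Rightarrow> real" +
  assumes pairing_integrable: "integrable P (\<lambda>\<omega>. L p \<omega> * M X \<omega>)"
    and pairing_bounded_left: "bounded_linear (\<lambda>X. pairing P L M p X)"
    and pairing_bounded_right: "bounded_linear (\<lambda>p. pairing P L M p X)"
    and dual_pair:
      "(\<forall>\<phi> :: 'm \<Rightarrow>\<^sub>L real. \<exists>p. \<forall>X. blinfun_apply \<phi> X = pairing P L M p X) \<or>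
       (\<forall>\<psi> :: 'l \<Rightarrow>\<^sub>L real. \<exists>X. \<forall>p. blinfun_apply \<psi> p = pairing P L M p X)"

definition functional_of ::
  "'a measure \<Rightarrow> ('l \<Rightarrow> 'a \<Rightarrow> real) \<Rightarrow> ('m::real_normed_vector \<Rightarrow> 'a \<Rightarrow> real) \<Rightarrow> 'l \<Rightarrow> ('m \<Rightarrow>\<^sub>L real)"
  where "functional_of P L M p = Blinfun (pairing P L M p)"

lemma (in paired_spaces) functional_of_apply:
  "blinfun_apply (functional_of P L M p) X = pairing P L M p X"
  using pairing_bounded_left[of p] by (simp add: functional_of_def bounded_linear_Blinfun_apply)

text \<open>The coarsest topology on \<^typ>\<open>'x\<close> that makes \<open>B i\<close> continuous for every \<open>i\<close>.\<close>

definition weak_topology :: "('i \<Rightarrow> 'x \<Rightarrow> real) \<Rightarrow> 'x topology" where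
  "weak_topology B = topology_generated_by {B i -` U | i U. open U}"

lemma topspace_weak_topology [simp]: "topspace (weak_topology B) = UNIV"
  unfolding weak_topology_def topology_generated_by_topspace
  by (auto intro!: exI[of _ UNIV])


section \<open>Extended-real-valued functions\<close>

definition proper_fun :: "('x \<Rightarrow> ereal) \<Rightarrow> bool" where
  "proper_fun f \<longleftrightarrow> (\<forall>x. f x \<noteq> -\<infinity>) \<and> (\<exists>x. f x \<noteq> \<infinity>)"

definition lower_semicontinuous_fun :: "'x topology \<Rightarrow> ('x \<Rightarrow> ereal) \<Rightarrow> bool" where
  "lower_semicontinuous_fun T f \<longleftrightarrow> (\<forall>a. closedin T {x \<in> topspace T. f x \<le> a})"

text \<open>In \<^typ>\<open>ereal\<close>, \<open>\<infinity> + (-\<infinity>) = \<infinity>\<close>, so that this agrees with convexity of the epigraph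
  also for functions taking both infinite values.\<close>

definition convex_fun :: "('x::real_vector \<Rightarrow> ereal) \<Rightarrow> bool" where
  "convex_fun f \<longleftrightarrow> (\<forall>x y. \<forall>t. 0 < t \<and> t < 1 \<longrightarrow>
     f ((1 - t) *\<^sub>R x + t *\<^sub>R y) \<le> ereal (1 - t) * f x + ereal t * f y)"

text \<open>In \<^typ>\<open>ereal\<close>, \<open>\<infinity> - \<infinity> = \<infinity>\<close>; hence the subdifferential of a proper function is empty
  at points where its value is \<open>\<infinity>\<close>.\<close>

definition subdifferential :: "('x::real_normed_vector \<Rightarrow> ereal) \<Rightarrow> 'x \<Rightarrow> ('x \<Rightarrow>\<^sub>L real) set" where
  "subdifferential f x = {\<eta>. \<forall>x'. f x' - f x \<ge> ereal (blinfun_apply \<eta> (x' - x))}"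

definition effective_domain :: "('x \<Rightarrow> ereal) \<Rightarrow> 'x set" where
  "effective_domain f = {x. f x < \<infinity>}"

definition positively_homogeneous :: "('x::real_vector \<Rightarrow> ereal) \<Rightarrow> bool" where
  "positively_homogeneous f \<longleftrightarrow> (\<forall>t\<ge>0. \<forall>x. f (t *\<^sub>R x) = ereal t * f x)"

end

theory Submission
  imports Defs
begin

text \<open>
  Everything except one implication in (5) is read off from the definition of \<open>\<Phi>\<close> by testing
  against suitable \<open>X\<close>. That implication rests on Fenchel--Moreau duality, for which no
  Hahn--Banach theorem is needed: a weak neighbourhood involves only finitely many functionals,
  so a point below the epigraph of a weakly lower semicontinuous convex function is separated
  from the epigraph by a nearest-point argument in finitely many coordinates. If
  \<open>V X\<^sub>0 > a > E X\<^sub>0\<close> and \<open>\<langle>q, X - X\<^sub>0\<rangle> + s (r - a) \<ge> c > 0\<close> on the epigraph, then averaging with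
  \<open>V \<ge> E\<close> shows that \<open>p = (1 - q) / (1 + s)\<close> lies in the domain of \<open>\<Phi>\<close>. If this domain is \<open>{1}\<close>,
  then \<open>p = 1\<close> and the same estimate gives \<open>\<Phi> 1 < 0\<close>, which is absurd; hence \<open>V = E\<close>.
\<close>

section \<open>Separation by finitely many functionals\<close>

text \<open>The vector \<open>w\<close> is the point nearest to the origin in the closure of the
  image of \<open>C\<close> under the coordinates \<open>f i\<close>. The image need not be closed,
  so \<open>w\<close> is obtained only as the coordinatewise limit of a minimizing sequence.
  Convexity puts the image beyond the hyperplane through \<open>w\<close> orthogonal to
  \<open>w\<close>.\<close>

lemma finite_functionals_separation:
  fixes f :: "'i \<Rightarrow> 'v::real_vector \<Rightarrow> real"
  assumes fin: "finite I" and lin: "\<And>i. i \<in> I \<Longrightarrow> linear (f i)"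
    and C: "convex C" and e: "e > 0" and far: "\<And>v. v \<in> C \<Longrightarrow> (\<Sum>i\<in>I. (f i v)\<^sup>2) \<ge> e"
  obtains w where "\<And>v. v \<in> C \<Longrightarrow> (\<Sum>i\<in>I. w i * f i v) \<ge> e"
proof (cases "C = {}")
  case True
  then show ?thesis using that by blast
next
  case False
  define q where "q v = (\<Sum>i\<in>I. (f i v)\<^sup>2)" for v
  define d where "d = Inf (q ` C)"
  have bdd: "bdd_below (q ` C)"
    using far by (auto simp: q_def intro!: bdd_belowI[of _ e])
  have d_le: "d \<le> q v" if "v \<in> C" for v
    unfolding d_def using bdd that by (intro cInf_lower) auto
  have e_le: "e \<le> d"
    unfolding d_def using False far by (intro cInf_greatest) (auto simp: q_def)
  have "\<exists>v\<in>C. q v < d + 1 / real (Suc k)" for k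
  proof -
    have "\<exists>y\<in>q ` C. y < d + 1 / real (Suc k)"
      unfolding d_def by (rule cInf_lessD) (use False in auto)
    then show ?thesis by blast
  qed
  then obtain z where zC: "\<And>k. z k \<in> C" and zq: "\<And>k. q (z k) < d + 1 / real (Suc k)"
    by metis
  \<comment> \<open>Parallelogram law for the squared seminorm \<open>q\<close>. Since
    \<open>q\<close> is at least \<open>d\<close> at the midpoint of two members of
    \<open>C\<close>, a minimizing sequence is Cauchy in every coordinate.\<close>
  have parallelogram: "q (u - v) = 2 * q u + 2 * q v - 4 * q ((1/2) *\<^sub>R u + (1/2) *\<^sub>R v)" for u v
    unfolding q_def sum_distrib_left sum.distrib[symmetric] sum_subtractf[symmetric]
    by (intro sum.cong)
       (auto simp: linear_diff[OF lin] linear_add[OF lin] linear_scale[OF lin]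
         power2_eq_square field_simps)
  have dist_le: "q (z k - z l) \<le> 2 / real (Suc k) + 2 / real (Suc l)" for k l
  proof -
    have "(1/2) *\<^sub>R z k + (1/2) *\<^sub>R z l \<in> C"
      using C zC by (intro convexD) auto
    from d_le[OF this] show ?thesis
      using parallelogram[of "z k" "z l"] zq[of k] zq[of l] by simp
  qed
  have "convergent (\<lambda>k. f i (z k))" if i: "i \<in> I" for i
  proof -
    have sq: "(f i (z k) - f i (z l))\<^sup>2 \<le> 2 / real (Suc k) + 2 / real (Suc l)" for k l
    proof -
      have "(f i (z k - z l))\<^sup>2 \<le> q (z k - z l)"
        unfolding q_def using fin i by (intro member_le_sum) auto
      also note dist_le
      finally show ?thesis by (simp add: linear_diff[OF lin[OF i]])
    qed
    have "Cauchy (\<lambda>k. f i (z k))"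
    proof (rule CauchyI)
      fix \<epsilon> :: real assume \<epsilon>: "\<epsilon> > 0"
      obtain N where N: "1 / real (Suc N) < \<epsilon>\<^sup>2 / 4"
        using \<epsilon> by (metis nat_approx_posE zero_less_divide_iff zero_less_numeral zero_less_power)
      have "norm (f i (z k) - f i (z l)) < \<epsilon>" if kl: "N \<le> k" "N \<le> l" for k l
      proof -
        have "1 / real (Suc k) \<le> 1 / real (Suc N)" "1 / real (Suc l) \<le> 1 / real (Suc N)"
          using kl by (auto intro!: divide_left_mono)
        then have "(f i (z k) - f i (z l))\<^sup>2 < \<epsilon>\<^sup>2"
          using sq[of k l] N by simp
        then have "\<bar>f i (z k) - f i (z l)\<bar> < \<epsilon>"
          using \<epsilon> by (intro power2_less_imp_less[of "\<bar>_\<bar>"]) auto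
        then show ?thesis by simp
      qed
      then show "\<exists>N. \<forall>k\<ge>N. \<forall>l\<ge>N. norm (f i (z k) - f i (z l)) < \<epsilon>" by blast
    qed
    then show ?thesis by (rule Cauchy_convergent)
  qed
  then obtain w where w: "\<And>i. i \<in> I \<Longrightarrow> (\<lambda>k. f i (z k)) \<longlonglongrightarrow> w i"
    unfolding convergent_def by metis
  have "(\<lambda>k. q (z k)) \<longlonglongrightarrow> d"
  proof (rule tendsto_sandwich)
    show "(\<lambda>k. d) \<longlonglongrightarrow> d" by (rule tendsto_const)
    show "(\<lambda>k. d + 1 / real (Suc k)) \<longlonglongrightarrow> d"
      using tendsto_add[OF tendsto_const[of d] LIMSEQ_inverse_real_of_nat]
      by (simp add: inverse_eq_divide)
  qed (intro always_eventually allI d_le zC less_imp_le[OF zq])+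
  moreover have "(\<lambda>k. q (z k)) \<longlonglongrightarrow> (\<Sum>i\<in>I. (w i)\<^sup>2)"
    unfolding q_def by (intro tendsto_intros w)
  ultimately have d_eq: "(\<Sum>i\<in>I. (w i)\<^sup>2) = d"
    using LIMSEQ_unique by blast
  have "(\<Sum>i\<in>I. w i * f i v) \<ge> e" if v: "v \<in> C" for v
  proof -
    \<comment> \<open>First variation at \<open>w\<close>: along the segment from \<open>w\<close>
      towards the image of \<open>v\<close> the squared length is
      \<open>d + 2 * t * b + t^2 * c\<close> and never drops below \<open>d\<close>. Dividing by
      \<open>t\<close> and letting \<open>t\<close> tend to 0 gives
      \<open>b \<ge> 0\<close>.\<close>
    define b where "b = (\<Sum>i\<in>I. w i * (f i v - w i))"
    define c where "c = (\<Sum>i\<in>I. (f i v - w i)\<^sup>2)"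
    have ineq: "0 \<le> 2 * b + t * c" if t: "0 < t" "t < 1" for t
    proof -
      have "d \<le> q ((1 - t) *\<^sub>R z k + t *\<^sub>R v)" for k
        using C zC v t by (intro d_le convexD) auto
      moreover have "q ((1 - t) *\<^sub>R z k + t *\<^sub>R v) = (\<Sum>i\<in>I. (f i (z k) + t * (f i v - f i (z k)))\<^sup>2)" for k
        unfolding q_def
        by (intro sum.cong) (auto simp: linear_add[OF lin] linear_diff[OF lin] linear_scale[OF lin] algebra_simps)
      moreover have "(\<lambda>k. \<Sum>i\<in>I. (f i (z k) + t * (f i v - f i (z k)))\<^sup>2)
          \<longlonglongrightarrow> (\<Sum>i\<in>I. (w i + t * (f i v - w i))\<^sup>2)"
        by (intro tendsto_intros w)
      ultimately have "d \<le> (\<Sum>i\<in>I. (w i + t * (f i v - w i))\<^sup>2)"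
        by (intro LIMSEQ_le_const) auto
      also have "\<dots> = (\<Sum>i\<in>I. (w i)\<^sup>2) + 2 * t * b + t\<^sup>2 * c"
        unfolding b_def c_def sum_distrib_left sum.distrib[symmetric]
        by (intro sum.cong) (auto simp: power2_eq_square algebra_simps)
      finally have "0 \<le> t * (2 * b + t * c)"
        using d_eq by (simp add: power2_eq_square algebra_simps)
      then show ?thesis using t by (simp add: zero_le_mult_iff)
    qed
    have "((\<lambda>t. 2 * b + t * c) \<longlongrightarrow> 2 * b + 0 * c) (at_right 0)"
      by (intro tendsto_intros)
    moreover have "eventually (\<lambda>t::real. 0 \<le> 2 * b + t * c) (at_right 0)"
      by (rule eventually_mono[OF eventually_at_right_real[of 0 1]]) (use ineq in auto)
    ultimately have "0 \<le> 2 * b + 0 * c"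
      by (intro tendsto_lowerbound) auto
    moreover have "b = (\<Sum>i\<in>I. w i * f i v) - (\<Sum>i\<in>I. (w i)\<^sup>2)"
      unfolding b_def by (simp add: algebra_simps power2_eq_square sum_subtractf)
    ultimately show ?thesis using d_eq e_le by linarith
  qed
  then show ?thesis by (rule that)
qed

section \<open>Weak neighbourhoods and separation from an epigraph\<close>

lemma openin_weak_topology_generator:
  assumes "open U"
  shows "openin (weak_topology B) (B i -` U)"
  unfolding weak_topology_def using assms by (intro topology_generated_by_Basis) auto

text \<open>Induction on the generation of the open set: an intersection merges two finite index
  sets and takes the smaller radius, a union inherits the data of one member containing
  \<open>x\<close>.\<close>

lemma weak_topology_neighbourhood:
  assumes "openin (weak_topology B) U" "x \<in> U"
  obtains I \<epsilon> where "finite I" "\<epsilon> > 0" "\<And>y. \<forall>i\<in>I. \<bar>B i y - B i x\<bar> < \<epsilon> \<Longrightarrow> y \<in> U"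
proof -
  have "generate_topology_on {B i -` U | i U. open U} U"
    using assms(1) by (simp add: weak_topology_def openin_topology_generated_by_iff)
  then have "\<exists>I \<epsilon>. finite I \<and> \<epsilon> > 0 \<and> (\<forall>y. (\<forall>i\<in>I. \<bar>B i y - B i x\<bar> < \<epsilon>) \<longrightarrow> y \<in> U)"
    using assms(2)
  proof (induction rule: generate_topology_on.induct)
    case Empty
    then show ?case by simp
  next
    case (Int U W)
    from Int obtain I \<epsilon> where I: "finite I" "\<epsilon> > 0" "\<And>y. (\<forall>i\<in>I. \<bar>B i y - B i x\<bar> < \<epsilon>) \<Longrightarrow> y \<in> U"
      by blast
    from Int obtain J \<delta> where J: "finite J" "\<delta> > 0" "\<And>y. (\<forall>i\<in>J. \<bar>B i y - B i x\<bar> < \<delta>) \<Longrightarrow> y \<in> W"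
      by blast
    show ?case
      by (rule exI[of _ "I \<union> J"], rule exI[of _ "min \<epsilon> \<delta>"]) (use I J in auto)
  next
    case (UN K)
    then obtain W where W: "W \<in> K" "x \<in> W" by blast
    then obtain I \<epsilon> where "finite I" "\<epsilon> > 0" "\<And>y. (\<forall>i\<in>I. \<bar>B i y - B i x\<bar> < \<epsilon>) \<Longrightarrow> y \<in> W"
      using UN.IH by blast
    with W show ?case by blast
  next
    case (Basis s)
    then obtain i W where s: "s = B i -` W" "open W" by auto
    with Basis obtain \<epsilon> where "\<epsilon> > 0" "\<And>r. dist r (B i x) < \<epsilon> \<Longrightarrow> r \<in> W"
      by (metis open_dist vimageE)
    then show ?case
      by (intro exI[of _ "{i}"] exI[of _ \<epsilon>]) (auto simp: s dist_real_def)
  qed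
  then show ?thesis using that by blast
qed

text \<open>Lower semicontinuity keeps the epigraph away from \<open>(x0, a)\<close> in finitely
  many coordinates, the height being one of them, so separation by finitely many functionals
  applies. The sign of \<open>s\<close> is left open here.\<close>

lemma epigraph_separation:
  fixes f :: "'x::real_vector \<Rightarrow> ereal" and B :: "'i \<Rightarrow> 'x \<Rightarrow> real"
  assumes lsc: "lower_semicontinuous_fun (weak_topology B) f" and cvx: "convex_fun f"
    and lin: "\<And>i. linear (B i)" and a: "ereal a < f x0"
  obtains I u s c where "finite I" "c > 0"
    "\<And>x r. f x \<le> ereal r \<Longrightarrow> (\<Sum>i\<in>I. u i * B i (x - x0)) + s * (r - a) \<ge> c"
proof -
  \<comment> \<open>The intermediate level gives vertical room: on a weak neighbourhood of
    \<open>x0\<close> the epigraph lies above \<open>a'\<close>, hence a definite distance above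
    \<open>a\<close>.\<close>
  obtain a' where a': "a < a'" "ereal a' < f x0"
    using ereal_dense2[OF a] by auto
  have "openin (weak_topology B) (UNIV - {x. f x \<le> ereal a'})"
    using lsc unfolding lower_semicontinuous_fun_def closedin_def by auto
  moreover have "x0 \<in> UNIV - {x. f x \<le> ereal a'}"
    using a' by auto
  ultimately obtain I \<epsilon> where I: "finite I" "\<epsilon> > 0"
      and nbh: "\<And>y. \<forall>i\<in>I. \<bar>B i y - B i x0\<bar> < \<epsilon> \<Longrightarrow> y \<in> UNIV - {x. f x \<le> ereal a'}"
    by (rule weak_topology_neighbourhood) blast
  \<comment> \<open>Coordinates on the product with the reals: \<open>None\<close> is the height,
    \<open>Some i\<close> the functional \<open>B i\<close>. The set \<open>C\<close> below is the
    epigraph translated so that \<open>(x0, a)\<close> becomes the origin.\<close>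
  define F where "F j v = (case j of None \<Rightarrow> snd v | Some i \<Rightarrow> B i (fst v))" for j and v :: "'x \<times> real"
  define J where "J = insert None (Some ` I)"
  define C where "C = {v. f (fst v + x0) \<le> ereal (snd v + a)}"
  define m where "m = min \<epsilon> (a' - a)"
  have m: "m > 0" using I a' by (simp add: m_def)
  have J_sum: "(\<Sum>j\<in>J. g j) = g None + (\<Sum>i\<in>I. g (Some i))" for g :: "'i option \<Rightarrow> real"
    unfolding J_def using I by (subst sum.insert) (auto simp: sum.reindex)
  have linF: "linear (F j)" for j
    using lin by (cases j)
      (auto intro!: linearI simp: F_def linear_add linear_scale)
  have "convex C"
  proof (rule convexI)
    fix v w :: "'x \<times> real" and s t :: real
    assume v: "v \<in> C" and w: "w \<in> C" and st: "0 \<le> s" "0 \<le> t" "s + t = 1"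
    show "s *\<^sub>R v + t *\<^sub>R w \<in> C"
    proof (cases "t = 0 \<or> t = 1")
      case True
      then show ?thesis using v w st by auto
    next
      case False
      then have t: "0 < t" "t < 1" and s: "s = 1 - t" using st by auto
      have "fst (s *\<^sub>R v + t *\<^sub>R w) + x0 = (1 - t) *\<^sub>R (fst v + x0) + t *\<^sub>R (fst w + x0)"
        by (simp add: s algebra_simps)
      then have "f (fst (s *\<^sub>R v + t *\<^sub>R w) + x0)
          \<le> ereal (1 - t) * f (fst v + x0) + ereal t * f (fst w + x0)"
        using cvx t by (simp add: convex_fun_def)
      also have "\<dots> \<le> ereal (1 - t) * ereal (snd v + a) + ereal t * ereal (snd w + a)"
        using v w t unfolding C_def by (intro add_mono ereal_mult_left_mono) auto
      also have "\<dots> = ereal (snd (s *\<^sub>R v + t *\<^sub>R w) + a)"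
        by (simp add: s algebra_simps)
      finally show ?thesis by (simp add: C_def)
    qed
  qed
  moreover have "(\<Sum>j\<in>J. (F j v)\<^sup>2) \<ge> m\<^sup>2" if v: "v \<in> C" for v
  proof -
    \<comment> \<open>If all coordinates were smaller than \<open>m\<close>, the base point would
      lie in the neighbourhood, where \<open>f\<close> exceeds \<open>a'\<close>, while the height
      would stay below \<open>a + (a' - a)\<close>.\<close>
    have "\<exists>j\<in>J. m \<le> \<bar>F j v\<bar>"
    proof (rule ccontr)
      assume "\<not> ?thesis"
      then have small: "\<bar>F j v\<bar> < m" if "j \<in> J" for j
        using that by (meson not_le)
      have "\<forall>i\<in>I. \<bar>B i (fst v + x0) - B i x0\<bar> < \<epsilon>"
        using small[of "Some i" for i] by (auto simp: J_def F_def m_def linear_add[OF lin])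
      from nbh[OF this] have "f (fst v + x0) > ereal a'"
        by auto
      also have "f (fst v + x0) \<le> ereal (snd v + a)"
        using v by (simp add: C_def)
      finally show False
        using small[of None] by (auto simp: J_def F_def m_def)
    qed
    then obtain j where j: "j \<in> J" "m \<le> \<bar>F j v\<bar>" by blast
    then have "m\<^sup>2 \<le> (F j v)\<^sup>2"
      using m power_mono[of m "\<bar>F j v\<bar>" 2] by simp
    also have "\<dots> \<le> (\<Sum>j\<in>J. (F j v)\<^sup>2)"
      using j I by (intro member_le_sum) (auto simp: J_def)
    finally show ?thesis .
  qed
  moreover have "finite J" "m\<^sup>2 > 0"
    using I m by (auto simp: J_def)
  ultimately obtain w where w: "\<And>v. v \<in> C \<Longrightarrow> (\<Sum>j\<in>J. w j * F j v) \<ge> m\<^sup>2"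
    by (rule_tac finite_functionals_separation[of J F C "m\<^sup>2"]) (use linF in auto)
  show ?thesis
  proof (rule that[of I "m\<^sup>2" "\<lambda>i. w (Some i)" "w None"])
    fix x r assume "f x \<le> ereal r"
    then have "(x - x0, r - a) \<in> C" by (simp add: C_def)
    from w[OF this] show "m\<^sup>2 \<le> (\<Sum>i\<in>I. w (Some i) * B i (x - x0)) + w None * (r - a)"
      by (simp add: J_sum F_def add.commute)
  qed (use I m in auto)
qed

section \<open>Conjugate functions\<close>

lemma ereal_diff_le_iff_real:
  fixes c :: ereal
  assumes "c \<noteq> -\<infinity>"
  shows "ereal b - c \<le> ereal d \<longleftrightarrow> ereal (b - d) \<le> c"
  using assms by (cases c) auto

definition conjugate :: "('l \<Rightarrow> 'm \<Rightarrow> real) \<Rightarrow> ('m \<Rightarrow> ereal) \<Rightarrow> 'l \<Rightarrow> ereal" where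
  "conjugate B f p = (SUP x. ereal (B p x) - f x)"

lemma conjugate_upper: "ereal (B p x) - f x \<le> conjugate B f p"
  unfolding conjugate_def by (rule SUP_upper) simp

lemma conjugate_le_iff: "conjugate B f p \<le> a \<longleftrightarrow> (\<forall>x. ereal (B p x) - f x \<le> a)"
  unfolding conjugate_def by (simp add: SUP_le_iff)

text \<open>The set where the supremum exceeds \<open>a\<close> is a union over \<open>x\<close> of
  preimages of open sets under evaluation at \<open>x\<close>; points with
  \<open>f x = \<infinity>\<close> contribute the empty set.\<close>

lemma lower_semicontinuous_conjugate:
  assumes "\<And>x. f x \<noteq> -\<infinity>"
  shows "lower_semicontinuous_fun (weak_topology (\<lambda>x p. B p x)) (conjugate B f)"
  unfolding lower_semicontinuous_fun_def
proof
  fix a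
  have "open {t. ereal t - f x > a}" for x
  proof (cases "f x")
    case (real v)
    have "{t. a < ereal t - f x} = {t. a < ereal (t - v)}"
      using real by simp
    also have "open \<dots>"
      by (intro open_Collect_less continuous_intros)
    finally show ?thesis .
  qed (use assms[of x] in auto)
  then have "openin (weak_topology (\<lambda>x p. B p x))
      (\<Union>x. (\<lambda>p. B p x) -` {t. ereal t - f x > a})"
    by (intro openin_Union ballI) (auto simp del: vimage_Collect_eq intro!: openin_weak_topology_generator)
  moreover have "UNIV - {p. conjugate B f p \<le> a} = (\<Union>x. (\<lambda>p. B p x) -` {t. ereal t - f x > a})"
    by (auto simp: conjugate_le_iff simp flip: not_le)
  ultimately show "closedin (weak_topology (\<lambda>x p. B p x))
      {p \<in> topspace (weak_topology (\<lambda>x p. B p x)). conjugate B f p \<le> a}"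
    by (simp add: closedin_def)
qed

text \<open>A supremum of functions affine in \<open>p\<close>; where
  \<open>f x = \<infinity>\<close>, the affine identity reads
  \<open>-\<infinity> = -\<infinity>\<close>.\<close>

lemma convex_conjugate:
  fixes B :: "'l::real_vector \<Rightarrow> 'm \<Rightarrow> real"
  assumes lin: "\<And>x. linear (\<lambda>p. B p x)" and f: "\<And>x. f x \<noteq> -\<infinity>"
  shows "convex_fun (conjugate B f)"
  unfolding convex_fun_def
proof (intro allI impI)
  fix p q :: 'l and t :: real assume t: "0 < t \<and> t < 1"
  have "ereal (B ((1 - t) *\<^sub>R p + t *\<^sub>R q) x) - f x
      \<le> ereal (1 - t) * conjugate B f p + ereal t * conjugate B f q" for x
  proof -
    have "ereal (B ((1 - t) *\<^sub>R p + t *\<^sub>R q) x) - f x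
        = ereal (1 - t) * (ereal (B p x) - f x) + ereal t * (ereal (B q x) - f x)"
      using f[of x] t
      by (cases "f x") (auto simp: linear_add[OF lin] linear_diff[OF lin] linear_scale[OF lin] algebra_simps)
    also have "\<dots> \<le> ereal (1 - t) * conjugate B f p + ereal t * conjugate B f q"
      using t by (intro add_mono ereal_mult_left_mono conjugate_upper) auto
    finally show ?thesis .
  qed
  then show "conjugate B f ((1 - t) *\<^sub>R p + t *\<^sub>R q)
      \<le> ereal (1 - t) * conjugate B f p + ereal t * conjugate B f q"
    by (simp add: conjugate_le_iff)
qed

text \<open>Any positive excess of \<open>B p\<close> over \<open>f\<close> at \<open>x\<close> is
  multiplied by \<open>n\<close> at the multiple \<open>n x\<close>, so a finite supremum rules it
  out.\<close>

lemma conjugate_positively_homogeneous: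
  fixes B :: "'l \<Rightarrow> 'm::real_vector \<Rightarrow> real"
  assumes lin: "linear (B p)" and f: "\<And>x. f x \<noteq> -\<infinity>" and hom: "positively_homogeneous f"
    and fin: "conjugate B f p < \<infinity>"
  shows "conjugate B f p \<le> 0"
proof -
  have "B p x - v \<le> 0" if v: "f x = ereal v" for x v
  proof (rule ccontr)
    assume pos: "\<not> B p x - v \<le> 0"
    have "f 0 = 0"
      using hom[unfolded positively_homogeneous_def, rule_format, of 0 x] v
      by (simp add: zero_ereal_def)
    then have "conjugate B f p \<ge> 0"
      using conjugate_upper[of B p 0 f] by (simp add: linear_0[OF lin] flip: zero_ereal_def)
    with fin obtain c where c: "conjugate B f p = ereal c"
      by (cases "conjugate B f p") auto
    obtain n :: nat where n: "c < real n * (B p x - v)"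
      using reals_Archimedean3[of "B p x - v"] pos by auto
    have "f (real n *\<^sub>R x) = ereal (real n * v)"
      using hom[unfolded positively_homogeneous_def, rule_format, of "real n" x] v by simp
    then have "real n * (B p x - v) \<le> c"
      using conjugate_upper[of B p "real n *\<^sub>R x" f] c
      by (simp add: linear_scale[OF lin] algebra_simps)
    with n show False by simp
  qed
  then have "ereal (B p x) - f x \<le> 0" for x
    using f[of x] by (cases "f x") (auto simp: zero_ereal_def)
  then show ?thesis by (simp add: conjugate_le_iff)
qed

text \<open>The hard implication of (5), with \<open>e\<close> in the role of the constant 1. The
  separating hyperplane may be vertical (\<open>s = 0\<close>); adding the minorant
  \<open>B e\<close> makes the coefficient of the height \<open>1 + s\<close>, so both cases are
  treated at once.\<close>

lemma effective_domain_conjugate_singleton: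
  fixes B :: "'l::real_vector \<Rightarrow> 'm::real_vector \<Rightarrow> real"
  assumes lin: "\<And>p. linear (B p)" and linB: "\<And>x. linear (\<lambda>p. B p x)"
    and f: "proper_fun f" "lower_semicontinuous_fun (weak_topology B) f" "convex_fun f"
    and minorant: "\<And>x. f x \<ge> ereal (B e x)" and f0: "f 0 = 0"
    and dom: "effective_domain (conjugate B f) = {e}"
  shows "f x0 = ereal (B e x0)"
proof (rule ccontr)
  assume "f x0 \<noteq> ereal (B e x0)"
  then have gap: "ereal (B e x0) < f x0"
    using minorant[of x0] by simp
  obtain I u s c where I: "finite I" and c: "c > 0"
    and sep: "\<And>x r. f x \<le> ereal r \<Longrightarrow> (\<Sum>i\<in>I. u i * B i (x - x0)) + s * (r - B e x0) \<ge> c"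
    by (rule epigraph_separation[OF f(2,3) lin gap]) blast
  \<comment> \<open>Linearity in the first argument gathers the finitely many functionals into one
    element.\<close>
  define q where "q = (\<Sum>i\<in>I. u i *\<^sub>R i)"
  have q: "(\<Sum>i\<in>I. u i * B i x) = B q x" for x
    by (simp add: q_def linear_sum[OF linB] linear_scale[OF linB])
  have "s \<ge> 0"
  proof (rule ccontr)
    assume s: "\<not> s \<ge> 0"
    \<comment> \<open>A height above \<open>f 0 = 0\<close> so large that, for negative
      \<open>s\<close>, the left side of \<open>sep\<close> at \<open>0\<close> is at most
      \<open>c + s < c\<close>.\<close>
    define r where "r = max 0 ((c - B q (0 - x0)) / s + B e x0 + 1)"
    have "s * (r - B e x0) \<le> s * ((c - B q (0 - x0)) / s + 1)"
      using s by (intro mult_left_mono_neg) (auto simp: r_def)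
    also have "\<dots> = c - B q (0 - x0) + s"
      using s by (simp add: field_simps)
    finally show False
      using sep[of 0 r] s f0 q by (simp add: r_def zero_ereal_def)
  qed
  \<comment> \<open>Adding \<open>r \<ge> B e x\<close> to the separation inequality and dividing by
    \<open>1 + s\<close> gives \<open>B p x + m \<le> r\<close>: slope \<open>p\<close> and
    intercept \<open>m\<close> of an affine minorant of \<open>f\<close>.\<close>
  define p where "p = (1 / (1 + s)) *\<^sub>R (e - q)"
  define m where "m = (B q x0 + s * B e x0 + c) / (1 + s)"
  have "conjugate B f p \<le> ereal (- m)"
    unfolding conjugate_le_iff
  proof
    fix x
    show "ereal (B p x) - f x \<le> ereal (- m)"
    proof (cases "f x")
      case (real r)
      have "B q (x - x0) + s * (r - B e x0) \<ge> c" "r \<ge> B e x"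
        using sep[of x r] minorant[of x] real q by auto
      then have "B e x - B q x + (B q x0 + s * B e x0 + c) \<le> r * (1 + s)"
        by (simp add: linear_diff[OF lin] algebra_simps)
      then have "(B e x - B q x + (B q x0 + s * B e x0 + c)) / (1 + s) \<le> r"
        using \<open>s \<ge> 0\<close> by (simp add: pos_divide_le_eq)
      moreover have "B p x = (B e x - B q x) / (1 + s)"
        by (simp add: p_def linear_scale[OF linB] linear_diff[OF linB])
      ultimately have "B p x + m \<le> r"
        by (simp add: m_def add_divide_distrib)
      then show ?thesis using real by simp
    qed (use f(1) in \<open>auto simp: proper_fun_def\<close>)
  qed
  moreover from this have "p \<in> effective_domain (conjugate B f)"
    unfolding effective_domain_def by (auto intro: le_less_trans)
  ultimately have "p = e" "conjugate B f e \<le> ereal (- m)"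
    using dom by auto
  moreover have "conjugate B f e \<ge> 0"
    using conjugate_upper[of B e 0 f] f0 by (simp add: linear_0[OF lin] flip: zero_ereal_def)
  ultimately have "0 \<le> ereal (- m)"
    by (metis order_trans)
  then have "m \<le> 0" by simp
  \<comment> \<open>Evaluating \<open>p = e\<close> at \<open>x0\<close> determines
    \<open>B q x0\<close>, which reduces \<open>m\<close> to the positive number
    \<open>c / (1 + s)\<close>.\<close>
  have "B p x0 = (B e x0 - B q x0) / (1 + s)"
    by (simp add: p_def linear_scale[OF linB] linear_diff[OF linB])
  then have "(1 + s) * B e x0 = B e x0 - B q x0"
    using \<open>p = e\<close> \<open>s \<ge> 0\<close> by (simp add: eq_divide_eq mult.commute)
  then have "B q x0 = - s * B e x0"
    by (simp add: algebra_simps)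
  then have "m = c / (1 + s)" by (simp add: m_def)
  with \<open>m \<le> 0\<close> c \<open>s \<ge> 0\<close> show False
    by (simp add: divide_le_0_iff)
qed

section \<open>The pairing\<close>

context paired_spaces
begin

abbreviation one :: 'l where "one \<equiv> ae_class P L (\<lambda>\<omega>. 1)"

lemma one_ae: "AE \<omega> in P. L one \<omega> = 1"
  by (rule L.ae_class_simple) simp

lemma one_unique: "(AE \<omega> in P. L p \<omega> = 1) \<longleftrightarrow> p = one"
proof
  assume "AE \<omega> in P. L p \<omega> = 1"
  then have "AE \<omega> in P. L p \<omega> = L one \<omega>"
    using one_ae by eventually_elim simp
  then show "p = one" by (rule L.rep_eqI)
qed (use one_ae in simp)

lemma linear_pairing_right: "linear (pairing P L M p)"
  using pairing_bounded_left by (rule bounded_linear.linear)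

lemma linear_pairing_left: "linear (\<lambda>p. pairing P L M p X)"
  using pairing_bounded_right by (rule bounded_linear.linear)

lemma M_zero: "AE \<omega> in P. M 0 \<omega> = 0"
  using M.rep_scaleR[of 0 0] by simp

lemma pairing_one: "pairing P L M one X = (\<integral>\<omega>. M X \<omega> \<partial>P)"
  unfolding pairing_def
  by (rule integral_cong_AE) (use one_ae L.rep_measurable M.rep_measurable in auto)

lemma pairing_AE_cong:
  assumes "AE \<omega> in P. M X \<omega> = g \<omega>" "g \<in> borel_measurable P"
  shows "integrable P (\<lambda>\<omega>. L p \<omega> * g \<omega>)" "pairing P L M p X = (\<integral>\<omega>. L p \<omega> * g \<omega> \<partial>P)"
proof -
  note [measurable] = L.rep_measurable M.rep_measurable assms(2)
  have ae: "AE \<omega> in P. L p \<omega> * M X \<omega> = L p \<omega> * g \<omega>"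
    using assms(1) by eventually_elim simp
  show "integrable P (\<lambda>\<omega>. L p \<omega> * g \<omega>)"
    by (rule integrable_cong_AE_imp[OF pairing_integrable[of p X]]) (use ae in auto)
  show "pairing P L M p X = (\<integral>\<omega>. L p \<omega> * g \<omega> \<partial>P)"
    unfolding pairing_def by (rule integral_cong_AE) (use ae in auto)
qed

text \<open>The sign of the difference of \<open>p\<close> and \<open>q\<close> is a simple
  function, hence represented in the second space; pairing with it yields the expectation of the
  absolute difference.\<close>

lemma pairing_eq_imp_ae_eq:
  assumes eq: "\<And>X. pairing P L M p X = pairing P L M q X"
  shows "p = q"
proof -
  note [measurable] = L.rep_measurable
  define g where "g \<omega> = sgn (L p \<omega> - L q \<omega>)" for \<omega>
  have [measurable]: "g \<in> borel_measurable P"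
    unfolding g_def by measurable
  have "simple_function P g"
    by (rule simple_function_borel_measurable)
       (auto simp: g_def sgn_real_def intro: finite_subset[of _ "{-1, 0, 1}"])
  then obtain X where X: "AE \<omega> in P. M X \<omega> = g \<omega>"
    using M.rep_simple by blast
  have abs_eq: "L p \<omega> * g \<omega> - L q \<omega> * g \<omega> = \<bar>L p \<omega> - L q \<omega>\<bar>" for \<omega>
    by (simp add: g_def sgn_real_def)
  note int = pairing_AE_cong(1)[OF X, of p] pairing_AE_cong(1)[OF X, of q]
  have "(\<integral>\<omega>. \<bar>L p \<omega> - L q \<omega>\<bar> \<partial>P) = (\<integral>\<omega>. L p \<omega> * g \<omega> \<partial>P) - (\<integral>\<omega>. L q \<omega> * g \<omega> \<partial>P)"
    using int by (simp add: abs_eq[symmetric])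
  also have "\<dots> = 0"
    using eq[of X] pairing_AE_cong(2)[OF X] by simp
  finally have zero: "(\<integral>\<omega>. \<bar>L p \<omega> - L q \<omega>\<bar> \<partial>P) = 0" .
  have "integrable P (\<lambda>\<omega>. \<bar>L p \<omega> - L q \<omega>\<bar>)"
    using Bochner_Integration.integrable_diff[OF int] by (simp add: abs_eq)
  from integral_nonneg_eq_0_iff_AE[OF this] zero
  have "AE \<omega> in P. \<bar>L p \<omega> - L q \<omega>\<bar> = 0" by simp
  then show ?thesis
    by (intro L.rep_eqI) simp
qed

text \<open>Test against large multiples of \<open>- 1\<^bsub>{L p < 0}\<^esub>\<close>, on which \<open>V\<close> is bounded by \<open>V 0\<close>.\<close>

lemma conjugate_monotone_nonneg:
  assumes mono: "\<And>X X'. (AE \<omega> in P. M X \<omega> \<le> M X' \<omega>) \<Longrightarrow> V X \<le> V X'"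
    and V0: "V 0 = 0" and fin: "conjugate (pairing P L M) V p < \<infinity>"
  shows "AE \<omega> in P. L p \<omega> \<ge> 0"
proof -
  note [measurable] = L.rep_measurable
  define g where "g \<omega> = (if L p \<omega> < 0 then -1 else 0 :: real)" for \<omega>
  have [measurable]: "g \<in> borel_measurable P"
    unfolding g_def by measurable
  have "simple_function P g"
    by (rule simple_function_borel_measurable)
       (auto simp: g_def intro: finite_subset[of _ "{-1, 0}"])
  then obtain Y where Y: "AE \<omega> in P. M Y \<omega> = g \<omega>"
    using M.rep_simple by blast
  have "conjugate (pairing P L M) V p \<ge> 0"
    using conjugate_upper[of "pairing P L M" p 0 V] V0
    by (simp add: linear_0[OF linear_pairing_right] flip: zero_ereal_def)
  with fin obtain c where c: "conjugate (pairing P L M) V p = ereal c"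
    by (cases "conjugate (pairing P L M) V p") auto
  have bound: "real n * pairing P L M p Y \<le> c" for n
  proof -
    have "AE \<omega> in P. M (real n *\<^sub>R Y) \<omega> \<le> M 0 \<omega>"
      using M.rep_scaleR[of "real n" Y] M_zero Y by eventually_elim (simp add: g_def)
    then have "V (real n *\<^sub>R Y) \<le> 0"
      using mono V0 by metis
    then have "ereal (real n * pairing P L M p Y) \<le> ereal (real n * pairing P L M p Y) - V (real n *\<^sub>R Y)"
      by (cases "V (real n *\<^sub>R Y)") auto
    also have "\<dots> \<le> ereal c"
      using conjugate_upper[of "pairing P L M" p "real n *\<^sub>R Y" V] c
      by (simp add: linear_scale[OF linear_pairing_right])
    finally show ?thesis by simp
  qed
  have le: "pairing P L M p Y \<le> 0"
    using bound reals_Archimedean3[of "pairing P L M p Y"] by (meson not_le)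
  \<comment> \<open>The product is the negative part of \<open>L p\<close>; its integral, already
    known to be at most 0, must therefore vanish.\<close>
  have nonneg: "L p \<omega> * g \<omega> \<ge> 0" for \<omega>
    by (simp add: g_def)
  have "(\<integral>\<omega>. L p \<omega> * g \<omega> \<partial>P) = 0"
    using le pairing_AE_cong(2)[OF Y, of p] nonneg
    by (intro antisym Bochner_Integration.integral_nonneg) auto
  with integral_nonneg_eq_0_iff_AE[OF pairing_AE_cong(1)[OF Y, of p]] nonneg
  have "AE \<omega> in P. L p \<omega> * g \<omega> = 0" by simp
  then show ?thesis
    by eventually_elim (auto simp: g_def split: if_splits)
qed

end

section \<open>Properties of the conjugate of \<open>V\<close>\<close>

theorem proposition1:
  fixes P :: "'a measure"
    and L :: "'l::banach \<Rightarrow> 'a \<Rightarrow> real"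
    and M :: "'m::banach \<Rightarrow> 'a \<Rightarrow> real"
    and V :: "'m \<Rightarrow> ereal"
    and \<Phi> :: "'l \<Rightarrow> ereal"
  assumes spaces: "paired_spaces P L M"
    and V1: "proper_fun V"
      "lower_semicontinuous_fun (weak_topology (\<lambda>p X. pairing P L M p X)) V"
      "convex_fun V"
    and V2: "\<And>X. V X \<ge> ereal (\<integral>\<omega>. M X \<omega> \<partial>P)"
      "\<And>X. V X = ereal (\<integral>\<omega>. M X \<omega> \<partial>P) \<longleftrightarrow> X = 0"
    and V3: "\<And>X X'. (AE \<omega> in P. M X \<omega> \<le> M X' \<omega>) \<Longrightarrow> V X \<le> V X'"
    and Phi: "\<And>p. \<Phi> p = (SUP X. ereal (pairing P L M p X) - V X)"
  shows "proper_fun \<Phi>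
    \<and> lower_semicontinuous_fun (weak_topology (\<lambda>X p. pairing P L M p X)) \<Phi>
    \<and> convex_fun \<Phi>
    \<and> (\<forall>p. \<Phi> p \<ge> 0)
    \<and> (\<forall>p. (AE \<omega> in P. L p \<omega> = 1) \<longrightarrow> \<Phi> p = 0)
    \<and> (\<forall>p. \<Phi> p < \<infinity> \<longrightarrow> (AE \<omega> in P. L p \<omega> \<ge> 0))
    \<and> (subdifferential V 0 = {functional_of P L M (ae_class P L (\<lambda>\<omega>. 1))} \<longrightarrow>
         (\<forall>p. \<Phi> p = 0 \<longrightarrow> (AE \<omega> in P. L p \<omega> = 1)))
    \<and> (subdifferential V 0 = {functional_of P L M (ae_class P L (\<lambda>\<omega>. 1))} \<longrightarrow>
         (effective_domain \<Phi> = {ae_class P L (\<lambda>\<omega>. 1)} \<longleftrightarrow> positively_homogeneous V))"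
proof -
  interpret paired_spaces P L M by (rule spaces)
  let ?B = "pairing P L M"
  have Phi_eq: "\<Phi> = conjugate ?B V"
    by (rule ext) (simp add: Phi conjugate_def)
  have V_ninf: "V X \<noteq> -\<infinity>" for X
    using V1(1) by (simp add: proper_fun_def)
  have minorant: "ereal (?B one X) \<le> V X" for X
    using V2(1) by (simp add: pairing_one)
  have V0: "V 0 = 0"
    using V2(2)[of 0] by (simp add: pairing_one[symmetric] linear_0[OF linear_pairing_right] zero_ereal_def)
  have nonneg: "\<Phi> p \<ge> 0" for p
    using conjugate_upper[of ?B p 0 V] V0 by (simp add: Phi_eq linear_0[OF linear_pairing_right] flip: zero_ereal_def)
  \<comment> \<open>Because \<open>\<Phi>\<close> is nonnegative, its zeros are exactly the linear
    minorants of \<open>V\<close>. As \<open>V 0 = 0\<close>, these are subgradients at 0, which is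
    how the hypothesis of (4) enters.\<close>
  have zero_iff: "\<Phi> p = 0 \<longleftrightarrow> (\<forall>X. ereal (?B p X) \<le> V X)" for p
  proof -
    have "\<Phi> p = 0 \<longleftrightarrow> \<Phi> p \<le> ereal 0"
      using nonneg[of p] by (auto simp: zero_ereal_def)
    also have "\<dots> \<longleftrightarrow> (\<forall>X. ereal (?B p X) \<le> V X)"
      unfolding Phi_eq conjugate_le_iff by (subst ereal_diff_le_iff_real) (use V_ninf in auto)
    finally show ?thesis .
  qed
  have Phi_one: "\<Phi> one = 0"
    using minorant by (simp add: zero_iff)
  have zero_imp: "p = one"
    if sub: "subdifferential V 0 = {functional_of P L M one}" and p: "\<Phi> p = 0" for p
  proof -
    have "functional_of P L M p \<in> subdifferential V 0"
      using p V0 by (simp add: subdifferential_def functional_of_apply zero_iff)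
    with sub have "functional_of P L M p = functional_of P L M one" by simp
    then have "?B p X = ?B one X" for X
      by (metis functional_of_apply)
    then show ?thesis by (rule pairing_eq_imp_ae_eq)
  qed
  have hom_imp: "effective_domain \<Phi> = {one}"
    if sub: "subdifferential V 0 = {functional_of P L M one}" and hom: "positively_homogeneous V"
  proof -
    have "p = one" if "\<Phi> p < \<infinity>" for p
    proof -
      have "\<Phi> p \<le> 0"
        using conjugate_positively_homogeneous[of ?B p V] linear_pairing_right V_ninf hom that
        by (simp add: Phi_eq)
      with nonneg[of p] have "\<Phi> p = 0" by (rule antisym[rotated])
      with sub show ?thesis by (rule zero_imp)
    qed
    then show ?thesis
      using Phi_one by (auto simp: effective_domain_def)
  qed
  have dom_imp: "positively_homogeneous V" if dom: "effective_domain \<Phi> = {one}"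
  proof -
    \<comment> \<open>Homogeneity comes from \<open>V\<close> being the expectation itself, a linear
      functional.\<close>
    have "V X = ereal (?B one X)" for X
      using effective_domain_conjugate_singleton[OF linear_pairing_right linear_pairing_left V1
          minorant V0] dom by (simp add: Phi_eq)
    then show ?thesis
      by (simp add: positively_homogeneous_def linear_scale[OF linear_pairing_right])
  qed
  have "proper_fun \<Phi>"
    unfolding proper_fun_def using nonneg Phi_one
    by (metis PInfty_neq_ereal(1) ereal_infty_less_eq(2) MInfty_neq_ereal(1) zero_ereal_def)
  moreover have "lower_semicontinuous_fun (weak_topology (\<lambda>X p. ?B p X)) \<Phi>"
    unfolding Phi_eq using V_ninf by (rule lower_semicontinuous_conjugate)
  moreover have "convex_fun \<Phi>"
    unfolding Phi_eq using linear_pairing_left V_ninf by (rule convex_conjugate)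
  moreover have "AE \<omega> in P. L p \<omega> \<ge> 0" if "\<Phi> p < \<infinity>" for p
    using conjugate_monotone_nonneg[of V p] V3 V0 that by (simp add: Phi_eq)
  ultimately show ?thesis
    using nonneg Phi_one zero_imp hom_imp dom_imp unfolding one_unique by blast
qed

end
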